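(* For a connected graph $G$ the inequality $$\mathrm{QEC}(P_2)\le \mathrm{QEC}(G)<\mathrm{QEC}(P_3)$$ holds if and only if $G=K_n$ for some $n\ge2$. Moreover, $\mathrm{QEC}(P_2)=\mathrm{QEC}(K_n)$ for all $n\ge2$. Therefore, there is no connected graph $G$ such that $\mathrm{QEC}(P_2)<\mathrm{QEC}(G)<\mathrm{QEC}(P_3)$.
   Context: All graphs are finite, simple and undirected; equality of graphs means isomorphism. $P_n$ is the path on $n$ vertices and $K_n$ the complete graph on $n$ vertices. For a connected graph $G=(V,E)$ with $|V|\ge2$, $d(i,j)$ denotes the length of a shortest walk connecting $i$ and $j$ (with $d(i,i)=0$), and $D=[d(i,j)]_{i,j\in V}$ is the distance matrix. $C(V)$ is the space of real-valued functions on $V$, $\langle\cdot,\cdot\rangle$ its canonical inner product, and $\mathbf 1$ the constant function with value $1$. The quadratic embedding constant of $G$ (defined only for connected graphs with at least two vertices, so $G$ is understood to have at least two vertices) is $$\mathrm{QEC}(G)=\max\{\langle f,Df\rangle : f\in C(V),\ \langle f,f\rangle=1,\ \langle \mathbf 1,f\rangle=0\}.$$ *)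

theory Defs
  imports "HOL-Analysis.Analysis" "Graph_Theory.Graph_Theory"
begin

text \<open>
  A finite simple undirected graph is a \<^locale>\<open>pair_graph\<close>: a finite, loop-free, symmetric digraph
  whose arcs are ordered pairs of vertices, so that an edge is a pair of opposite arcs.
  Since \<^const>\<open>Topological_Spaces.connected\<close> is also in scope, connectedness of graphs is always
  written \<^const>\<open>Digraph_Component.connected\<close>.
\<close>

definition path_graph :: "nat \<Rightarrow> nat pair_pre_digraph" where
  "path_graph n =
    \<lparr> pverts = {0..<n}, parcs = {(i, j). i < n \<and> j < n \<and> (j = Suc i \<or> i = Suc j)} \<rparr>"

definition complete_graph :: "nat \<Rightarrow> nat pair_pre_digraph" where
  "complete_graph n = \<lparr> pverts = {0..<n}, parcs = {(i, j). i < n \<and> j < n \<and> i \<noteq> j} \<rparr>"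

text \<open>
  The length of a walk is its number of arcs; the empty walk from a vertex to itself is a walk.
\<close>

definition graph_dist :: "'a pair_pre_digraph \<Rightarrow> 'a \<Rightarrow> 'a \<Rightarrow> nat" where
  "graph_dist G i j =
    (LEAST k. \<exists>p. pre_digraph.awalk (with_proj G) i p j \<and> length p = k)"

text \<open>
  An element of \<open>C(V)\<close> is represented by a function on the whole vertex type; only its values on
  \<open>V\<close> enter the sums below.
\<close>

definition inner_on :: "'a set \<Rightarrow> ('a \<Rightarrow> real) \<Rightarrow> ('a \<Rightarrow> real) \<Rightarrow> real" where
  "inner_on V f g = (\<Sum>i\<in>V. f i * g i)"

definition dist_op :: "'a pair_pre_digraph \<Rightarrow> ('a \<Rightarrow> real) \<Rightarrow> 'a \<Rightarrow> real" where
  "dist_op G f i = (\<Sum>j\<in>pverts G. real (graph_dist G i j) * f j)"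

definition QEC_values :: "'a pair_pre_digraph \<Rightarrow> real set" where
  "QEC_values G = {inner_on (pverts G) f (dist_op G f) | f.
     inner_on (pverts G) f f = 1 \<and> inner_on (pverts G) (\<lambda>_. 1) f = 0}"

text \<open>
  The maximum is taken literally, as the greatest element of the set of values; it exists for every
  graph with at least two vertices (lemma \<open>QEC_is_max\<close> below).
\<close>

definition QEC :: "'a pair_pre_digraph \<Rightarrow> real" where
  "QEC G = (GREATEST q. q \<in> QEC_values G)"

lemma pair_graph_path_graph: "pair_graph (path_graph n)"
proof -
  have "parcs (path_graph n) \<subseteq> {0..<n} \<times> {0..<n}" by (auto simp: path_graph_def)
  then have "finite (parcs (path_graph n))" by (rule finite_subset) simp
  then show ?thesis
    by unfold_locales (auto simp: path_graph_def symmetric_def sym_def)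
qed

lemma complete_digraph_complete_graph: "complete_digraph n (with_proj (complete_graph n))"
  unfolding complete_digraph_pair_def by (auto simp: complete_graph_def)

lemma pair_graph_complete_graph: "pair_graph (complete_graph n)"
  by (rule pair_graphI_complete[OF complete_digraph_complete_graph])

lemma graph_dist_eq_shortest_path:
  assumes "pair_graph G" "Digraph_Component.connected (with_proj G)"
    and "i \<in> pverts G" "j \<in> pverts G"
  shows "ereal (real (graph_dist G i j)) = wf_digraph.\<mu> (with_proj G) (\<lambda>_. 1) i j"
proof -
  interpret pair_graph G by fact
  have cost: "awalk_cost (\<lambda>_. 1) p = real (length p)" for p :: "('a \<times> 'a) list"
    by (induction p) auto
  have "strongly_connected (with_proj G)"
    using symmetric_connected_imp_strongly_connected[OF pair_sym_arcs assms(2)] .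
  then have "i \<rightarrow>\<^sup>*\<^bsub>with_proj G\<^esub> j"
    using assms(3,4) by (auto simp: strongly_connected_def)
  then obtain p0 where "awalk i p0 j" by (auto simp: reachable_awalk)
  then have ex: "\<exists>k. \<exists>p. awalk i p j \<and> length p = k" by blast
  obtain p where p: "awalk i p j" "length p = graph_dist G i j"
    using LeastI_ex[OF ex] unfolding graph_dist_def by blast
  have le: "graph_dist G i j \<le> length q" if "awalk i q j" for q
    unfolding graph_dist_def by (rule Least_le) (use that in blast)
  show ?thesis
    unfolding \<mu>_def cost using p le
    by (intro antisym INF_greatest INF_lower2[of p]) auto
qed

lemma QEC_values_attains_max:
  assumes fin: "finite (pverts G)" and card: "2 \<le> card (pverts G)"
  shows "\<exists>m\<in>QEC_values G. \<forall>q\<in>QEC_values G. q \<le> m"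
proof -
  let ?V = "pverts G"
  define B where "B = PiE UNIV (\<lambda>i. if i \<in> ?V then {-1..1::real} else {0})"
  define S where "S = {f \<in> B. inner_on ?V f f = 1 \<and> inner_on ?V (\<lambda>_. 1) f = 0}"
  define F where "F = (\<lambda>f. inner_on ?V f (dist_op G f))"
  have coord: "continuous_on UNIV (\<lambda>f::'a \<Rightarrow> real. f i)" for i
    by (rule continuous_on_product_coordinates)
  have cont: "continuous_on UNIV F"
    unfolding F_def inner_on_def dist_op_def by (intro continuous_intros coord)
  have "compact B"
    unfolding B_def compactin_euclidean_iff[symmetric] euclidean_product_topology[symmetric]
    by (subst compactin_PiE) auto
  moreover have "closed {f. inner_on ?V f f = 1 \<and> inner_on ?V (\<lambda>_. 1) f = 0}"
    unfolding inner_on_def by (intro closed_Collect_conj closed_Collect_eq continuous_intros coord)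
  ultimately have "compact S"
    unfolding S_def using compact_Int_closed by (simp add: Collect_conj_eq)
  have vals: "QEC_values G = F ` S"
  proof
    show "F ` S \<subseteq> QEC_values G" by (auto simp: QEC_values_def F_def S_def)
    show "QEC_values G \<subseteq> F ` S"
    proof
      fix q assume "q \<in> QEC_values G"
      then obtain f where f: "q = F f" "inner_on ?V f f = 1" "inner_on ?V (\<lambda>_. 1) f = 0"
        by (auto simp: QEC_values_def F_def)
      define g where "g = (\<lambda>i. if i \<in> ?V then f i else 0)"
      have bound: "\<bar>f i\<bar> \<le> 1" if "i \<in> ?V" for i
      proof -
        have "f i * f i \<le> inner_on ?V f f"
          unfolding inner_on_def using that fin by (intro member_le_sum) auto
        then show ?thesis using f(2) abs_square_le_1[of "f i"] by (simp add: power2_eq_square)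
      qed
      have "g \<in> B" using bound by (auto simp: B_def g_def abs_le_iff PiE_iff)
      moreover have "inner_on ?V g g = inner_on ?V f f"
          "inner_on ?V (\<lambda>_. 1) g = inner_on ?V (\<lambda>_. 1) f" "F g = F f"
        by (auto simp: inner_on_def dist_op_def F_def g_def intro!: sum.cong)
      ultimately show "q \<in> F ` S" using f by (auto simp: S_def intro!: image_eqI[of _ _ g])
    qed
  qed
  obtain a b where ab: "a \<in> ?V" "b \<in> ?V" "a \<noteq> b"
    using card fin by (metis card_2_iff' ex_card subsetD)
  define h where "h = (\<lambda>i. if i = a then 1 / sqrt 2 else if i = b then - 1 / sqrt 2 else 0)"
  have "inner_on ?V h h = (\<Sum>i\<in>{a,b}. h i * h i)" "inner_on ?V (\<lambda>_. 1) h = (\<Sum>i\<in>{a,b}. h i)"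
    unfolding inner_on_def mult_1 using ab fin
    by (intro sum.mono_neutral_right; simp add: h_def)+
  then have "F h \<in> QEC_values G" using ab by (auto simp: QEC_values_def F_def h_def)
  then have "S \<noteq> {}" using vals by auto
  then obtain s where "s \<in> S" "\<forall>f\<in>S. F f \<le> F s"
    using continuous_attains_sup[OF \<open>compact S\<close>] continuous_on_subset[OF cont] by blast
  then show ?thesis unfolding vals by blast
qed

lemma QEC_is_max:
  assumes "finite (pverts G)" "2 \<le> card (pverts G)"
  shows "QEC G \<in> QEC_values G" and "q \<in> QEC_values G \<Longrightarrow> q \<le> QEC G"
proof -
  obtain m where m: "m \<in> QEC_values G" "\<And>q. q \<in> QEC_values G \<Longrightarrow> q \<le> m"
    using QEC_values_attains_max[OF assms] by blast
  have "QEC G = m" unfolding QEC_def by (rule Greatest_equality) (use m in auto)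
  then show "QEC G \<in> QEC_values G" and "q \<in> QEC_values G \<Longrightarrow> q \<le> QEC G" using m by auto
qed

end

theory Submission
  imports Defs
begin

text \<open>
  Two vertices of a complete graph are at distance \<open>1\<close>, so that on functions \<open>f\<close> with sum \<open>0\<close> and norm
  \<open>1\<close> the quadratic form is \<open>(\<Sum>i. f i)\<^sup>2 - (\<Sum>i. (f i)\<^sup>2) = -1\<close>: every complete graph with at least two
  vertices has the constant \<open>-1\<close>, and \<open>P\<^sub>2\<close> is one of them. A connected graph that is not complete
  contains an induced path on three vertices \<open>x, y, z\<close>, because otherwise adjacency would be
  transitive and would reach everything. Then \<open>d(x, z) = 2\<close>, and the test function
  \<open>(1, -2, 1) / sqrt 6\<close> on \<open>x, y, z\<close> shows that the constant is at least \<open>-2/3\<close>. The path \<open>P\<^sub>3\<close>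
  attains exactly \<open>-2/3\<close>, that test function being a maximizer.

  Hence the constant of a connected graph is \<open>-1 = QEC(P\<^sub>2)\<close> if the graph is complete and at least
  \<open>-2/3 = QEC(P\<^sub>3)\<close> otherwise, and all three claims follow from this dichotomy
  (\<open>QEC_complete\<close>, \<open>obtain_induced_path3\<close>, \<open>QEC_ge_if_induced_path3\<close>, \<open>QEC_path_graph_3\<close>).
\<close>

section \<open>Distances up to two\<close>

context pair_graph
begin

lemma graph_dist_self: "i \<in> pverts G \<Longrightarrow> graph_dist G i i = 0"
  unfolding graph_dist_def by (rule Least_eq_0) (auto simp: awalk_Nil_iff)

lemma graph_dist_arc:
  assumes "(i, j) \<in> parcs G"
  shows "graph_dist G i j = 1"
  unfolding graph_dist_def
proof (rule Least_equality)
  have "awalk i [(i, j)] j"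
    using assms by (auto simp: awalk_simps in_arcsD2)
  then show "\<exists>p. awalk i p j \<and> length p = 1" by force
next
  fix k assume "\<exists>p. awalk i p j \<and> length p = k"
  moreover have "i \<noteq> j" using pair_no_loops[OF assms] by simp
  ultimately show "1 \<le> k" by (cases k) (auto simp: awalk_Nil_iff)
qed

lemma graph_dist_two:
  assumes "(i, j) \<in> parcs G" "(j, k) \<in> parcs G" "i \<noteq> k" "(i, k) \<notin> parcs G"
  shows "graph_dist G i k = 2"
  unfolding graph_dist_def
proof (rule Least_equality)
  have "awalk i [(i, j), (j, k)] k"
    using assms by (auto simp: awalk_simps in_arcsD2)
  then show "\<exists>p. awalk i p k \<and> length p = 2" by force
next
  fix m assume "\<exists>p. awalk i p k \<and> length p = m"
  then obtain p where p: "awalk i p k" "length p = m" by blast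
  then show "2 \<le> m"
    using assms(3,4) by (cases p rule: list.exhaust; cases "tl p") (auto simp: awalk_simps)
qed

section \<open>Induced paths on three vertices\<close>

text \<open>
  Without an induced path on three vertices, being equal or adjacent is preserved along every walk,
  so in a connected graph any two distinct vertices are adjacent.
\<close>

lemma obtain_induced_path3:
  assumes conn: "Digraph_Component.connected (with_proj G)"
    and not_complete: "\<not> complete_digraph (card (pverts G)) (with_proj G)"
  obtains x y z where "(x, y) \<in> parcs G" "(y, z) \<in> parcs G" "x \<noteq> z" "(x, z) \<notin> parcs G"
proof -
  have "\<exists>x y z. (x, y) \<in> parcs G \<and> (y, z) \<in> parcs G \<and> x \<noteq> z \<and> (x, z) \<notin> parcs G"
  proof (rule ccontr)
    assume no_path: "\<not> ?thesis"
    have adjacent: "(u, v) \<in> parcs G" if "u \<in> pverts G" "v \<in> pverts G" "u \<noteq> v" for u v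
    proof -
      have "strongly_connected (with_proj G)"
        using symmetric_connected_imp_strongly_connected[OF pair_sym_arcs conn] .
      then have "u \<rightarrow>\<^sup>*\<^bsub>with_proj G\<^esub> v"
        using that by (auto simp: strongly_connected_def)
      then have "u = v \<or> (u, v) \<in> parcs G"
      proof (induction rule: reachable_induct)
        case base
        then show ?case by simp
      next
        case (step a b)
        then show ?case using no_path by auto
      qed
      then show ?thesis using that by simp
    qed
    have "parcs G = {(u, v). (u, v) \<in> pverts G \<times> pverts G \<and> u \<noteq> v}"
      using adjacent by (auto dest: in_arcsD1 in_arcsD2 pair_no_loops)
    then show False
      using not_complete pair_finite_verts unfolding complete_digraph_pair_def by simp
  qed
  then show ?thesis using that by blast
qed

text \<open>
  The lower bound is tested on the function with values \<open>1, -2, 1\<close> along the path, scaled to norm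
  \<open>1\<close>. Its norm before scaling is \<open>sqrt 6\<close>, and the quadratic form is \<open>-4\<close>.
\<close>

lemma QEC_ge_if_induced_path3:
  assumes arcs: "(x, y) \<in> parcs G" "(y, z) \<in> parcs G" "x \<noteq> z" "(x, z) \<notin> parcs G"
  shows "- 2 / 3 \<le> QEC G"
proof -
  let ?V = "pverts G"
  have arcs': "(y, x) \<in> parcs G" "(z, y) \<in> parcs G" "(z, x) \<notin> parcs G"
    using arcs pair_sym_arcs by (auto simp: symmetric_def dest: symD)
  have ne: "x \<noteq> y" "y \<noteq> z" using arcs pair_no_loops by fastforce+
  have V: "x \<in> ?V" "y \<in> ?V" "z \<in> ?V" using arcs by (auto dest: in_arcsD1 in_arcsD2)
  define f where "f i = (if i = y then - 2 / sqrt 6 else if i = x \<or> i = z then 1 / sqrt 6 else 0)"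
    for i
  have restrict: "(\<Sum>i\<in>?V. h i * f i) = h x * f x + h y * f y + h z * f z" for h
  proof -
    have "(\<Sum>i\<in>?V. h i * f i) = (\<Sum>i\<in>{x, y, z}. h i * f i)"
      using V pair_finite_verts by (intro sum.mono_neutral_right) (auto simp: f_def)
    then show ?thesis using ne arcs(3) by (simp add: add.assoc)
  qed
  have f_values: "f x = 1 / sqrt 6" "f y = - 2 / sqrt 6" "f z = 1 / sqrt 6"
    using ne by (simp_all add: f_def)
  have dist: "graph_dist G x x = 0" "graph_dist G y y = 0" "graph_dist G z z = 0"
    "graph_dist G x y = 1" "graph_dist G y x = 1" "graph_dist G y z = 1" "graph_dist G z y = 1"
    "graph_dist G x z = 2" "graph_dist G z x = 2"
    using V arcs arcs' graph_dist_two[OF arcs] graph_dist_two[OF arcs'(2,1)]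
    by (auto simp: graph_dist_self graph_dist_arc)
  have "inner_on ?V f f = 1" "inner_on ?V (\<lambda>_. 1) f = 0"
    unfolding inner_on_def restrict f_values by simp_all
  moreover have "inner_on ?V f (dist_op G f) = - 2 / 3"
  proof -
    have "inner_on ?V f (dist_op G f) = (\<Sum>i\<in>?V. dist_op G f i * f i)"
      by (simp add: inner_on_def mult.commute)
    then show ?thesis
      unfolding restrict unfolding dist_op_def restrict f_values dist by simp
  qed
  ultimately have "- 2 / 3 \<in> QEC_values G"
    unfolding QEC_values_def by force
  moreover have "2 \<le> card ?V"
    using V ne card_mono[OF pair_finite_verts, of "{x, y}"] by simp
  ultimately show ?thesis using QEC_is_max(2) pair_finite_verts by blast
qed

end

section \<open>Complete graphs\<close>

lemma QEC_complete:
  assumes complete: "complete_digraph n (with_proj G)" and n: "2 \<le> n"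
  shows "QEC G = - 1"
proof -
  interpret pair_graph G using complete by (rule pair_graphI_complete)
  let ?V = "pverts G"
  have arcs: "parcs G = {(u, v). (u, v) \<in> ?V \<times> ?V \<and> u \<noteq> v}" and card: "card ?V = n"
    using complete by (auto simp: complete_digraph_pair_def)
  have "q = - 1" if "q \<in> QEC_values G" for q
  proof -
    from that obtain f where f: "q = inner_on ?V f (dist_op G f)" "inner_on ?V f f = 1"
      "(\<Sum>i\<in>?V. f i) = 0"
      by (auto simp: QEC_values_def inner_on_def)
    have "dist_op G f i = - f i" if i: "i \<in> ?V" for i
    proof -
      have "dist_op G f i = (\<Sum>j\<in>?V. f j - (if j = i then f i else 0))"
        unfolding dist_op_def using i
        by (intro sum.cong) (auto simp: arcs graph_dist_self graph_dist_arc)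
      then show ?thesis using i f(3) pair_finite_verts by (simp add: sum_subtractf)
    qed
    then have "q = - inner_on ?V f f"
      unfolding f(1) inner_on_def by (simp add: sum_negf)
    then show ?thesis using f(2) by simp
  qed
  then show ?thesis using QEC_is_max(1)[of G] pair_finite_verts card n by blast
qed

lemma complete_path_graph_2: "complete_digraph 2 (with_proj (path_graph 2))"
  unfolding complete_digraph_pair_def by (auto simp: path_graph_def)

text \<open>
  An isomorphism onto a complete graph reflects adjacency of distinct vertices. Conversely, an
  enumeration of the vertices of a complete graph is an isomorphism, since adjacency means being
  distinct on both sides.
\<close>

lemma digraph_iso_complete_graph_iff:
  assumes "pair_graph G"
  shows "digraph_iso (with_proj G) (with_proj (complete_graph n)) \<longleftrightarrow>
    complete_digraph n (with_proj G)"
proof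
  interpret pair_graph G by fact
  assume "digraph_iso (with_proj G) (with_proj (complete_graph n))"
  then obtain f where f: "digraph_isomorphism f"
    and image: "with_proj (complete_graph n) = app_iso f (with_proj G)"
    unfolding digraph_iso_def by blast
  let ?g = "iso_verts f"
  have inj: "inj_on ?g (pverts G)" using f by (simp add: digraph_isomorphism_def)
  have verts: "{0..<n} = ?g ` pverts G"
    using arg_cong[OF image, of verts] by (simp add: complete_graph_def)
  have arcs: "{(i, j). i < n \<and> j < n \<and> i \<noteq> j} = (\<lambda>(u, v). (?g u, ?g v)) ` parcs G"
    using arg_cong[OF image, of arcs_ends] arcs_ends_app_iso_eq[OF f]
    by (simp add: complete_graph_def)
  have "card (pverts G) = n" using card_image[OF inj] unfolding verts[symmetric] by simp
  moreover have "(u, v) \<in> parcs G" if "u \<in> pverts G" "v \<in> pverts G" "u \<noteq> v" for u v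
  proof -
    have "?g u \<in> {0..<n}" "?g v \<in> {0..<n}" using that verts by auto
    moreover have "?g u \<noteq> ?g v" using that inj by (auto dest: inj_onD)
    ultimately have "(?g u, ?g v) \<in> (\<lambda>(u, v). (?g u, ?g v)) ` parcs G"
      unfolding arcs[symmetric] by simp
    then obtain u' v' where uv': "(u', v') \<in> parcs G" "?g u' = ?g u" "?g v' = ?g v" by auto
    then have "u' = u" "v' = v"
      using that inj by (auto dest: inj_onD in_arcsD1 in_arcsD2)
    then show ?thesis using uv' by simp
  qed
  ultimately show "complete_digraph n (with_proj G)"
    unfolding complete_digraph_pair_def using pair_finite_verts
    by (auto dest: in_arcsD1 in_arcsD2 pair_no_loops)
next
  interpret pair_graph G by fact
  assume "complete_digraph n (with_proj G)"
  then have card: "card (pverts G) = n"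
    and arcs: "parcs G = {(u, v). (u, v) \<in> pverts G \<times> pverts G \<and> u \<noteq> v}"
    by (auto simp: complete_digraph_pair_def)
  obtain g where "bij_betw g (pverts G) {0..<n}"
    using ex_bij_betw_finite_nat[OF pair_finite_verts] card by blast
  then have inj: "inj_on g (pverts G)" and verts: "g ` pverts G = {0..<n}"
    by (auto simp: bij_betw_def)
  define f where "f = \<lparr> iso_verts = g, iso_arcs = map_prod g g, iso_head = snd, iso_tail = fst \<rparr>"
  have "inj_on (map_prod g g) (parcs G)"
    using map_prod_inj_on[OF inj inj] by (rule inj_on_subset) (auto simp: arcs)
  then have "digraph_isomorphism f"
    using inj wf_digraph_axioms by (simp add: digraph_isomorphism_def f_def)
  moreover have "map_prod g g ` parcs G = {(i, j). i < n \<and> j < n \<and> i \<noteq> j}"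
  proof (intro equalityI subsetI)
    fix e assume "e \<in> map_prod g g ` parcs G"
    then show "e \<in> {(i, j). i < n \<and> j < n \<and> i \<noteq> j}"
      using verts inj by (auto simp: arcs dest: inj_onD)
  next
    fix e assume "e \<in> {(i, j). i < n \<and> j < n \<and> i \<noteq> j}"
    then obtain i j where ij: "e = (i, j)" "i \<in> g ` pverts G" "j \<in> g ` pverts G" "i \<noteq> j"
      unfolding verts by auto
    then show "e \<in> map_prod g g ` parcs G" by (auto simp: arcs intro!: image_eqI)
  qed
  then have "with_proj (complete_graph n) = app_iso f (with_proj G)"
    unfolding app_iso_def f_def with_proj_def complete_graph_def using verts by simp
  ultimately show "digraph_iso (with_proj G) (with_proj (complete_graph n))"
    unfolding digraph_iso_def by blast
qed

section \<open>The path on three vertices\<close>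

text \<open>
  Eliminating the value at the middle vertex, \<open>b = - (a + c)\<close>, the quadratic form becomes
  \<open>-2 (a\<^sup>2 + c\<^sup>2)\<close> and the norm condition becomes \<open>2 (a\<^sup>2 + a c + c\<^sup>2) = 1\<close>. The bound is then
  \<open>(a - c)\<^sup>2 \<ge> 0\<close>.
\<close>

lemma QEC_path_graph_3: "QEC (path_graph 3) = - 2 / 3"
proof (rule antisym)
  let ?P = "path_graph 3"
  interpret pair_graph ?P by (rule pair_graph_path_graph)
  have verts: "pverts ?P = {0, 1, 2}" by (auto simp: path_graph_def)
  have path: "(0, 1) \<in> parcs ?P" "(1, 2) \<in> parcs ?P" "(0, 2) \<notin> parcs ?P"
    "(1, 0) \<in> parcs ?P" "(2, 1) \<in> parcs ?P" "(2, 0) \<notin> parcs ?P"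
    by (auto simp: path_graph_def)
  show "- 2 / 3 \<le> QEC ?P"
    by (rule QEC_ge_if_induced_path3[of 0 1 2]) (use path in auto)
  have "graph_dist ?P 0 2 = 2" "graph_dist ?P 2 0 = 2"
    using graph_dist_two[OF path(1,2)] graph_dist_two[OF path(5,4)] path by auto
  then have dist: "graph_dist ?P 0 0 = 0" "graph_dist ?P 1 1 = 0" "graph_dist ?P 2 2 = 0"
    "graph_dist ?P 0 1 = 1" "graph_dist ?P 1 0 = 1" "graph_dist ?P 1 2 = 1" "graph_dist ?P 2 1 = 1"
    "graph_dist ?P 0 2 = 2" "graph_dist ?P 2 0 = 2"
    using path by (simp_all add: graph_dist_self graph_dist_arc verts)
  have "q \<le> - 2 / 3" if "q \<in> QEC_values ?P" for q
  proof -
    from that obtain f where f: "q = inner_on (pverts ?P) f (dist_op ?P f)"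
      "inner_on (pverts ?P) f f = 1" "inner_on (pverts ?P) (\<lambda>_. 1) f = 0"
      by (auto simp: QEC_values_def)
    define a b c where "a = f 0" and "b = f 1" and "c = f 2"
    have sum3: "(\<Sum>i\<in>{0, 1, 2::nat}. h i) = h 0 + h 1 + h 2" for h :: "nat \<Rightarrow> real"
      by (simp add: add.assoc)
    have b: "b = - (a + c)" and norm: "a * a + b * b + c * c = 1"
      using f(2,3) unfolding inner_on_def verts sum3 a_def b_def c_def by simp_all
    have "q = a * (b + 2 * c) + b * (a + c) + c * (2 * a + b)"
      unfolding f(1) inner_on_def dist_op_def verts sum3 dist a_def b_def c_def by simp
    then have "q = - 2 * (a * a + c * c)" unfolding b by (simp add: algebra_simps)
    moreover have "2 * (a * a) + 2 * (a * c) + 2 * (c * c) = 1"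
      using norm unfolding b by (simp add: algebra_simps)
    moreover have "0 \<le> a * a + c * c - 2 * (a * c)"
      using zero_le_square[of "a - c"] by (simp add: algebra_simps)
    ultimately show ?thesis by simp
  qed
  then show "QEC ?P \<le> - 2 / 3"
    using QEC_is_max(1)[of ?P] by (simp add: verts)
qed

section \<open>The gap between the two paths\<close>

theorem theorem4p6:
  shows "(\<forall>G :: 'a pair_pre_digraph.
            pair_graph G \<and> Digraph_Component.connected (with_proj G) \<and> 2 \<le> card (pverts G) \<longrightarrow>
            (QEC (path_graph 2) \<le> QEC G \<and> QEC G < QEC (path_graph 3) \<longleftrightarrow>
              (\<exists>n\<ge>2. digraph_iso (with_proj G) (with_proj (complete_graph n)))))
       \<and> (\<forall>n\<ge>2. QEC (path_graph 2) = QEC (complete_graph n))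
       \<and> \<not> (\<exists>G :: 'a pair_pre_digraph.
            pair_graph G \<and> Digraph_Component.connected (with_proj G) \<and> 2 \<le> card (pverts G) \<and>
            QEC (path_graph 2) < QEC G \<and> QEC G < QEC (path_graph 3))"
proof -
  have P2: "QEC (path_graph 2) = - 1"
    using QEC_complete[OF complete_path_graph_2] by simp
  have Kn: "QEC (complete_graph n) = - 1" if "2 \<le> n" for n
    using QEC_complete[OF complete_digraph_complete_graph that] .
  have noncomplete: "- 2 / 3 \<le> QEC G"
    if "pair_graph G" "Digraph_Component.connected (with_proj G)"
      "\<not> complete_digraph (card (pverts G)) (with_proj G)" for G :: "'a pair_pre_digraph"
    using pair_graph.obtain_induced_path3[OF that] pair_graph.QEC_ge_if_induced_path3[OF that(1)]
    by metis
  have iff: "QEC (path_graph 2) \<le> QEC G \<and> QEC G < QEC (path_graph 3) \<longleftrightarrow>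
      (\<exists>n\<ge>2. digraph_iso (with_proj G) (with_proj (complete_graph n)))"
    and no_gap: "\<not> (QEC (path_graph 2) < QEC G \<and> QEC G < QEC (path_graph 3))"
    if G: "pair_graph G" "Digraph_Component.connected (with_proj G)" "2 \<le> card (pverts G)"
    for G :: "'a pair_pre_digraph"
  proof -
    have complete_iff: "(\<exists>n\<ge>2. digraph_iso (with_proj G) (with_proj (complete_graph n))) \<longleftrightarrow>
        complete_digraph (card (pverts G)) (with_proj G)"
      unfolding digraph_iso_complete_graph_iff[OF G(1)] using G(3)
      by (auto simp: complete_digraph_def)
    show "QEC (path_graph 2) \<le> QEC G \<and> QEC G < QEC (path_graph 3) \<longleftrightarrow>
        (\<exists>n\<ge>2. digraph_iso (with_proj G) (with_proj (complete_graph n)))"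
      and "\<not> (QEC (path_graph 2) < QEC G \<and> QEC G < QEC (path_graph 3))"
      unfolding complete_iff P2 QEC_path_graph_3
      using QEC_complete[OF _ G(3)] noncomplete[OF G(1,2)] by force+
  qed
  show ?thesis using iff no_gap P2 Kn by auto
qed

end
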